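(* Let $X\neq\emptyset$ be a set and let $\mathcal E\colon \mathcal F(X)\to[0,\infty]$ be convex with $\mathcal E(0)=0$. Then the following are equivalent: (i) $\mathcal E$ is lower semicontinuous with respect to pointwise convergence. (ii) For some $1\le p<\infty$ we have $\mathcal E=\sup\{\mathcal E^{(\alpha,K)}_p\mid K\subset X\text{ finite and }\alpha>0\}$ (pointwise supremum). (iii) For every $1\le p<\infty$ we have $\mathcal E=\sup\{\mathcal E^{(\alpha,K)}_p\mid K\subset X\text{ finite and }\alpha>0\}$.
   Context: $\mathcal F(X)$ is the real vector space of all functions $f\colon X\to\mathbb R$, equipped with the topology of pointwise convergence. $\mathcal E$ is lower semicontinuous if $\mathcal E(f)\le\liminf_i\mathcal E(f_i)$ for every net $(f_i)$ converging pointwise to $f$. For a finite set $K\subset X$, $\alpha>0$ and $1\le p<\infty$, the functional $\mathcal E^{(\alpha,K)}_p\colon\mathcal F(X)\to[0,\infty]$ is defined by $$\mathcal E^{(\alpha,K)}_p(f)=\inf\Big\{\mathcal E(g)+\alpha\sum_{x\in K}|f(x)-g(x)|^p\ \Big|\ g\in\mathcal F(X)\Big\}.$$ *)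

theory Defs
  imports "HOL-Analysis.Analysis"
begin

definition convex_functional :: "(('a \<Rightarrow> real) \<Rightarrow> ennreal) \<Rightarrow> bool" where
  "convex_functional E \<longleftrightarrow>
    (\<forall>f g. \<forall>t\<in>{0..1}.
      E (\<lambda>x. (1 - t) * f x + t * g x) \<le> ennreal (1 - t) * E f + ennreal t * E g)"

text \<open>Lower semicontinuity with respect to pointwise convergence. A net is represented by the
  filter on the function space generated by the images of its tails. In this way nets over
  arbitrary directed index sets are covered without quantifying over index types; the lemmas
  \<open>pointwise_lsc_net\<close> and \<open>pointwise_lscI_net\<close> below give the formulation with directed sets.\<close>

definition pointwise_lsc :: "(('a \<Rightarrow> real) \<Rightarrow> ennreal) \<Rightarrow> bool" where
  "pointwise_lsc E \<longleftrightarrow>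
    (\<forall>f F. (\<forall>x. ((\<lambda>g. g x) \<longlongrightarrow> f x) F) \<longrightarrow> E f \<le> Liminf F E)"

definition approx_functional ::
    "(('a \<Rightarrow> real) \<Rightarrow> ennreal) \<Rightarrow> real \<Rightarrow> real \<Rightarrow> 'a set \<Rightarrow> ('a \<Rightarrow> real) \<Rightarrow> ennreal" where
  "approx_functional E p \<alpha> K f =
    (INF g. E g + ennreal (\<alpha> * (\<Sum>x\<in>K. \<bar>f x - g x\<bar> powr p)))"

definition directed_index :: "'i set \<Rightarrow> ('i \<Rightarrow> 'i \<Rightarrow> bool) \<Rightarrow> bool" where
  "directed_index I le \<longleftrightarrow> I \<noteq> {} \<and> (\<forall>i\<in>I. le i i) \<and>
    (\<forall>i\<in>I. \<forall>j\<in>I. \<forall>k\<in>I. le i j \<longrightarrow> le j k \<longrightarrow> le i k) \<and>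
    (\<forall>i\<in>I. \<forall>j\<in>I. \<exists>k\<in>I. le i k \<and> le j k)"

definition net_pointwise_lim ::
    "'i set \<Rightarrow> ('i \<Rightarrow> 'i \<Rightarrow> bool) \<Rightarrow> ('i \<Rightarrow> 'a \<Rightarrow> real) \<Rightarrow> ('a \<Rightarrow> real) \<Rightarrow> bool" where
  "net_pointwise_lim I le h f \<longleftrightarrow>
    (\<forall>x. \<forall>\<epsilon>>0. \<exists>i\<in>I. \<forall>j\<in>I. le i j \<longrightarrow> \<bar>h j x - f x\<bar> < \<epsilon>)"

definition net_liminf :: "'i set \<Rightarrow> ('i \<Rightarrow> 'i \<Rightarrow> bool) \<Rightarrow> ('i \<Rightarrow> ennreal) \<Rightarrow> ennreal" where
  "net_liminf I le u = (SUP i\<in>I. INF j\<in>{j\<in>I. le i j}. u j)"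

lemma pointwise_lsc_net:
  fixes E :: "('a \<Rightarrow> real) \<Rightarrow> ennreal" and I :: "'i set"
  assumes lsc: "pointwise_lsc E" and dir: "directed_index I le"
    and lim: "net_pointwise_lim I le h f"
  shows "E f \<le> net_liminf I le (\<lambda>i. E (h i))"
proof -
  define F where "F = (INF i\<in>I. principal (h ` {j\<in>I. le i j}))"
  have ev: "eventually P F \<longleftrightarrow> (\<exists>i\<in>I. \<forall>j\<in>I. le i j \<longrightarrow> P (h j))" for P
  proof -
    have "eventually P F \<longleftrightarrow> (\<exists>i\<in>I. eventually P (principal (h ` {j\<in>I. le i j})))"
      unfolding F_def
    proof (rule eventually_INF_base)
      show "I \<noteq> {}" using dir by (simp add: directed_index_def)
    next
      fix a b assume ab: "a \<in> I" "b \<in> I"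
      then obtain k where k: "k \<in> I" "le a k" "le b k"
        using dir unfolding directed_index_def by blast
      have "h ` {j\<in>I. le k j} \<subseteq> h ` {j\<in>I. le a j} \<inter> h ` {j\<in>I. le b j}"
        using dir ab k unfolding directed_index_def by blast
      with k show "\<exists>x\<in>I. principal (h ` {j\<in>I. le x j})
          \<le> inf (principal (h ` {j\<in>I. le a j})) (principal (h ` {j\<in>I. le b j}))"
        by auto
    qed
    then show ?thesis by (auto simp: eventually_principal)
  qed
  have "\<forall>x. ((\<lambda>g. g x) \<longlongrightarrow> f x) F"
    using lim by (simp add: tendsto_iff ev net_pointwise_lim_def dist_real_def)
  then have "E f \<le> Liminf F E" using lsc by (simp add: pointwise_lsc_def)
  also have "Liminf F E \<le> net_liminf I le (\<lambda>i. E (h i))"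
    unfolding Liminf_def
  proof (rule SUP_least)
    fix P assume "P \<in> {P. eventually P F}"
    then obtain i where i: "i \<in> I" "\<forall>j\<in>I. le i j \<longrightarrow> P (h j)" using ev by auto
    have "Inf (E ` Collect P) \<le> (INF j\<in>{j\<in>I. le i j}. E (h j))"
      using i by (intro INF_greatest INF_lower) auto
    also have "\<dots> \<le> net_liminf I le (\<lambda>i. E (h i))"
      unfolding net_liminf_def using i(1) by (rule SUP_upper)
    finally show "Inf (E ` Collect P) \<le> net_liminf I le (\<lambda>i. E (h i))" .
  qed
  finally show ?thesis .
qed

lemma pointwise_lscI_net:
  fixes E :: "('a \<Rightarrow> real) \<Rightarrow> ennreal"
  assumes nets: "\<And>(I :: (('a \<Rightarrow> real) set \<times> ('a \<Rightarrow> real)) set) le h f.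
      directed_index I le \<Longrightarrow> net_pointwise_lim I le h f \<Longrightarrow>
      E f \<le> net_liminf I le (\<lambda>i. E (h i))"
  shows "pointwise_lsc E"
  unfolding pointwise_lsc_def
proof (intro allI impI)
  fix f :: "'a \<Rightarrow> real" and F :: "('a \<Rightarrow> real) filter"
  assume lim: "\<forall>x. ((\<lambda>g. g x) \<longlongrightarrow> f x) F"
  show "E f \<le> Liminf F E"
  proof (cases "F = bot")
    case True
    then show ?thesis by simp
  next
    case False
    define I where "I = {(A, g). eventually (\<lambda>u. u \<in> A) F \<and> g \<in> A}"
    define le :: "('a \<Rightarrow> real) set \<times> ('a \<Rightarrow> real) \<Rightarrow> ('a \<Rightarrow> real) set \<times> ('a \<Rightarrow> real) \<Rightarrow> bool"
      where "le = (\<lambda>i j. fst j \<subseteq> fst i)"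
    have ne: "\<exists>g. g \<in> A" if "eventually (\<lambda>u. u \<in> A) F" for A
      using eventually_happens[OF that] False by auto
    have "directed_index I le"
      unfolding directed_index_def
    proof (intro conjI ballI impI)
      have "(UNIV, f) \<in> I" by (simp add: I_def)
      then show "I \<noteq> {}" by blast
      fix i j assume ij: "i \<in> I" "j \<in> I"
      then have e: "eventually (\<lambda>u. u \<in> fst i \<inter> fst j) F"
        by (auto simp: I_def intro: eventually_conj)
      obtain g where "g \<in> fst i \<inter> fst j" using ne[OF e] by blast
      with e have "(fst i \<inter> fst j, g) \<in> I" by (simp add: I_def)
      then show "\<exists>k\<in>I. le i k \<and> le j k"
        by (rule bexI[rotated]) (simp add: le_def)
    qed (auto simp: le_def)
    moreover have "net_pointwise_lim I le snd f"
      unfolding net_pointwise_lim_def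
    proof (intro allI impI)
      fix x and \<epsilon> :: real assume "\<epsilon> > 0"
      define A where "A = {g. \<bar>g x - f x\<bar> < \<epsilon>}"
      have e: "eventually (\<lambda>u. u \<in> A) F"
        using lim \<open>\<epsilon> > 0\<close> by (simp add: A_def tendsto_iff dist_real_def)
      obtain g where "g \<in> A" using ne[OF e] by blast
      with e have "(A, g) \<in> I" by (simp add: I_def)
      moreover have "\<forall>j\<in>I. le (A, g) j \<longrightarrow> \<bar>snd j x - f x\<bar> < \<epsilon>"
        by (auto simp: I_def le_def A_def)
      ultimately show "\<exists>i\<in>I. \<forall>j\<in>I. le i j \<longrightarrow> \<bar>snd j x - f x\<bar> < \<epsilon>" by blast
    qed
    ultimately have "E f \<le> net_liminf I le (\<lambda>i. E (snd i))" by (rule nets)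
    also have "\<dots> \<le> Liminf F E"
      unfolding net_liminf_def
    proof (rule SUP_least)
      fix i assume "i \<in> I"
      then have e: "eventually (\<lambda>u. u \<in> fst i) F" by (auto simp: I_def)
      have "(INF j\<in>{j\<in>I. le i j}. E (snd j)) \<le> E g" if "g \<in> fst i" for g
      proof -
        have "(fst i, g) \<in> {j\<in>I. le i j}" using e that by (simp add: I_def le_def)
        then show ?thesis by (rule INF_lower2) simp
      qed
      then have "(INF j\<in>{j\<in>I. le i j}. E (snd j)) \<le> Inf (E ` {u. u \<in> fst i})"
        by (intro INF_greatest) auto
      also have "\<dots> \<le> Liminf F E"
        unfolding Liminf_def by (rule SUP_upper2[of "\<lambda>u. u \<in> fst i"]) (use e in auto)
      finally show "(INF j\<in>{j\<in>I. le i j}. E (snd j)) \<le> Liminf F E" .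
    qed
    finally show ?thesis .
  qed
qed

end

theory Submission
  imports Defs
begin

text \<open>If \<open>E\<close> exceeds \<open>c\<close> on the basic neighbourhood of \<open>f\<close> given by a finite set \<open>K\<close> and a
  radius \<open>e\<close>, then every \<open>g\<close> outside this neighbourhood pays a penalty of at least
  \<open>\<alpha> * e powr p\<close>, which exceeds \<open>c\<close> for large \<open>\<alpha>\<close>; hence the regularisations recover a lower
  semicontinuous \<open>E\<close>. Conversely each regularisation is itself lower semicontinuous: only those
  \<open>g\<close> that stay at bounded distance from \<open>f\<close> on \<open>K\<close> matter, and there the penalty is uniformly
  continuous.\<close>

lemma pointwise_lsc_Sup:
  assumes "\<And>h. h \<in> A \<Longrightarrow> pointwise_lsc h"
  shows "pointwise_lsc (Sup A)"
  unfolding pointwise_lsc_def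
proof (intro allI impI)
  fix f :: "'a \<Rightarrow> real" and F
  assume lim: "\<forall>x. ((\<lambda>g. g x) \<longlongrightarrow> f x) F"
  have "h f \<le> Liminf F (Sup A)" if "h \<in> A" for h
  proof -
    have "h f \<le> Liminf F h"
      using assms[OF that] lim by (simp add: pointwise_lsc_def)
    also have "\<dots> \<le> Liminf F (Sup A)"
      using that by (intro Liminf_mono always_eventually allI) (auto intro: SUP_upper)
    finally show ?thesis .
  qed
  then show "Sup A f \<le> Liminf F (Sup A)"
    by (auto intro!: SUP_least)
qed

text \<open>Lower semicontinuity is tested on the neighbourhood filter of \<open>f\<close> for
  pointwise convergence, generated by the sets \<open>N (K, e)\<close>. Exceeding \<open>c\<close>
  eventually along this filter means exceeding it on one generator.\<close>

lemma pointwise_lsc_neighbourhood: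
  fixes E :: "('a \<Rightarrow> real) \<Rightarrow> ennreal"
  assumes "pointwise_lsc E" and "c < E f"
  obtains K e where "finite K" "e > 0" "\<And>g. (\<And>x. x \<in> K \<Longrightarrow> \<bar>f x - g x\<bar> < e) \<Longrightarrow> c < E g"
proof -
  define I where "I = {(K :: 'a set, e :: real). finite K \<and> 0 < e}"
  define N where "N = (\<lambda>(K :: 'a set, e). {g. \<forall>x\<in>K. \<bar>f x - g x\<bar> < e})"
  define F where "F = (INF i\<in>I. principal (N i))"
  have ev: "eventually P F \<longleftrightarrow> (\<exists>i\<in>I. eventually P (principal (N i)))" for P
    unfolding F_def
  proof (rule eventually_INF_base)
    have "({}, 1) \<in> I" by (simp add: I_def)
    then show "I \<noteq> {}" by blast
  next
    fix i j assume "i \<in> I" "j \<in> I"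
    then have "(fst i \<union> fst j, min (snd i) (snd j)) \<in> I"
      and "N (fst i \<union> fst j, min (snd i) (snd j)) \<subseteq> N i \<inter> N j"
      by (auto simp: I_def N_def)
    then show "\<exists>k\<in>I. principal (N k) \<le> inf (principal (N i)) (principal (N j))"
      by (metis inf_principal principal_le_iff)
  qed
  have "((\<lambda>g. g x) \<longlongrightarrow> f x) F" for x
    unfolding tendsto_iff ev
  proof (intro allI impI)
    fix e :: real assume "e > 0"
    then show "\<exists>i\<in>I. eventually (\<lambda>g. dist (g x) (f x) < e) (principal (N i))"
      by (intro bexI[of _ "({x}, e)"])
        (auto simp: I_def N_def eventually_principal dist_real_def abs_minus_commute)
  qed
  then have "E f \<le> Liminf F E"
    using assms(1) by (simp add: pointwise_lsc_def)
  with \<open>c < E f\<close> have "eventually (\<lambda>g. c < E g) F"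
    by (simp add: le_Liminf_iff)
  with that show thesis
    by (auto simp: ev I_def N_def eventually_principal)
qed

lemma approx_functional_le:
  "approx_functional E p \<alpha> K f \<le> E f"
  unfolding approx_functional_def by (rule INF_lower2[of f]) auto

text \<open>For \<open>p > 1\<close> the map \<open>\<bar>s\<bar> powr p\<close> is not uniformly
  continuous on the whole line, so \<open>s\<close> is confined to a bounded interval. The interval
  is enlarged by 1 and \<delta> cut down to at most 1, which keeps \<open>t\<close> in the same
  compact set.\<close>

lemma uniform_penalty:
  fixes p R \<epsilon> :: real
  assumes "p > 0" "\<epsilon> > 0"
  obtains \<delta> where "\<delta> > 0"
    "\<And>s t. \<bar>s\<bar> \<le> R \<Longrightarrow> \<bar>t - s\<bar> < \<delta> \<Longrightarrow> \<bar>t\<bar> powr p \<le> \<bar>s\<bar> powr p + \<epsilon>"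
proof -
  have "continuous_on {-R-1..R+1} (\<lambda>s :: real. \<bar>s\<bar> powr p)"
    using \<open>p > 0\<close> by (intro continuous_on_powr' continuous_intros) auto
  then have "uniformly_continuous_on {-R-1..R+1} (\<lambda>s :: real. \<bar>s\<bar> powr p)"
    by (rule compact_uniformly_continuous) simp
  then obtain \<delta> where \<delta>: "\<delta> > 0" "\<And>s t. s \<in> {-R-1..R+1} \<Longrightarrow> t \<in> {-R-1..R+1} \<Longrightarrow>
      dist t s < \<delta> \<Longrightarrow> dist (\<bar>t\<bar> powr p) (\<bar>s\<bar> powr p) < \<epsilon>"
    using \<open>\<epsilon> > 0\<close> unfolding uniformly_continuous_on_def by metis
  show thesis
  proof (rule that[of "min \<delta> 1"])
    show "min \<delta> 1 > 0" using \<delta>(1) by simp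
  next
    fix s t assume "\<bar>s\<bar> \<le> R" "\<bar>t - s\<bar> < min \<delta> 1"
    then show "\<bar>t\<bar> powr p \<le> \<bar>s\<bar> powr p + \<epsilon>"
      using \<delta>(2)[of s t] by (simp add: dist_real_def abs_le_iff abs_less_iff)
  qed
qed

text \<open>An infimum of lower semicontinuous functions need not be lower semicontinuous; what
  helps here is that \<delta> can be chosen before \<open>g\<close>, so one neighbourhood of
  \<open>f\<close> serves all competitors.\<close>

lemma pointwise_lsc_approx_functional:
  fixes E :: "('a \<Rightarrow> real) \<Rightarrow> ennreal"
  assumes "p > 0" "\<alpha> > 0" "finite K"
  shows "pointwise_lsc (approx_functional E p \<alpha> K)"
  unfolding pointwise_lsc_def
proof (intro allI impI)
  fix f :: "'a \<Rightarrow> real" and F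
  assume lim: "\<forall>x. ((\<lambda>g. g x) \<longlongrightarrow> f x) F"
  let ?A = "approx_functional E p \<alpha> K"
  define S where "S u g = \<alpha> * (\<Sum>x\<in>K. \<bar>u x - g x\<bar> powr p)" for u g :: "'a \<Rightarrow> real"
  have A_le: "?A u \<le> E g + ennreal (S u g)" for u g
    unfolding approx_functional_def S_def by (rule INF_lower) simp
  have "eventually (\<lambda>u. y < ?A u) F" if "y < ?A f" for y
  proof -
    \<comment> \<open>Two intermediate values are needed: the gap from \<open>y'\<close> to
      \<open>y''\<close> pays for the change of the penalty, and the gap from \<open>y\<close> to
      \<open>y'\<close> restores strictness after the infimum over \<open>g\<close>.\<close>
    obtain y' where y': "y < y'" "y' < ?A f"
      using dense[OF \<open>y < ?A f\<close>] by blast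
    obtain y'' where y'': "y' < y''" "y'' < ?A f"
      using dense[OF y'(2)] by blast
    obtain c where c: "c \<ge> 0" "y' = ennreal c"
      using y'' by (cases y') auto
    obtain d where d: "y'' = ennreal d" "c < d"
      using y'' c by (cases y'') (auto simp: ennreal_less_iff)
    \<comment> \<open>The summand 1 keeps \<open>n\<close> positive for empty \<open>K\<close>. With
      this \<epsilon>, an error of \<epsilon> at each point of \<open>K\<close> costs at most
      \<open>\<alpha> * n * \<epsilon> = d - c\<close> in total.\<close>
    define n where "n = real (card K) + 1"
    have "n > 0" by (simp add: n_def)
    define \<epsilon> where "\<epsilon> = (d - c) / (\<alpha> * n)"
    have "\<epsilon> > 0" using \<open>\<alpha> > 0\<close> \<open>n > 0\<close> d by (simp add: \<epsilon>_def)
    \<comment> \<open>The largest distance between \<open>u x\<close> and \<open>g x\<close>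
      compatible with a penalty of at most \<open>c\<close>.\<close>
    define R where "R = (c / \<alpha>) powr (1 / p)"
    obtain \<delta> where \<delta>: "\<delta> > 0"
      "\<And>s t. \<bar>s\<bar> \<le> R \<Longrightarrow> \<bar>t - s\<bar> < \<delta> \<Longrightarrow> \<bar>t\<bar> powr p \<le> \<bar>s\<bar> powr p + \<epsilon>"
      using uniform_penalty[OF \<open>p > 0\<close> \<open>\<epsilon> > 0\<close>] by blast
    have "eventually (\<lambda>u. \<forall>x\<in>K. \<bar>u x - f x\<bar> < \<delta>) F"
      using lim \<open>\<delta> > 0\<close> \<open>finite K\<close>
      by (intro eventually_ball_finite) (auto simp: tendsto_iff dist_real_def)
    then show ?thesis
    proof eventually_elim
      fix u assume u: "\<forall>x\<in>K. \<bar>u x - f x\<bar> < \<delta>"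
      have "y' \<le> E g + ennreal (S u g)" for g
      proof (cases "S u g \<le> c")
        case False
        then have "y' \<le> ennreal (S u g)" using c by (simp add: ennreal_leI)
        then show ?thesis by (simp add: add_increasing)
      next
        case True
        \<comment> \<open>The uniform estimate is applied with \<open>s = u x - g x\<close> and
          \<open>t = f x - g x\<close>, whose difference \<open>f x - u x\<close> does not involve
          \<open>g\<close>.\<close>
        have "\<bar>f x - g x\<bar> powr p \<le> \<bar>u x - g x\<bar> powr p + \<epsilon>" if "x \<in> K" for x
        proof (rule \<delta>(2))
          have "\<bar>u x - g x\<bar> powr p \<le> (\<Sum>x\<in>K. \<bar>u x - g x\<bar> powr p)"
            using that \<open>finite K\<close> by (intro member_le_sum) auto
          also have "\<dots> \<le> c / \<alpha>"
            using True \<open>\<alpha> > 0\<close> by (simp add: S_def field_simps)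
          finally have "(\<bar>u x - g x\<bar> powr p) powr (1 / p) \<le> R"
            unfolding R_def using \<open>p > 0\<close> by (intro powr_mono2) auto
          then show "\<bar>u x - g x\<bar> \<le> R"
            using \<open>p > 0\<close> by (simp add: powr_powr)
        qed (use u that in \<open>auto simp: abs_minus_commute\<close>)
        then have "(\<Sum>x\<in>K. \<bar>f x - g x\<bar> powr p) \<le> (\<Sum>x\<in>K. \<bar>u x - g x\<bar> powr p + \<epsilon>)"
          by (rule sum_mono)
        also have "\<dots> \<le> (\<Sum>x\<in>K. \<bar>u x - g x\<bar> powr p) + n * \<epsilon>"
          using \<open>\<epsilon> > 0\<close> by (simp add: sum.distrib n_def)
        finally have "S f g \<le> \<alpha> * ((\<Sum>x\<in>K. \<bar>u x - g x\<bar> powr p) + n * \<epsilon>)"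
          unfolding S_def using \<open>\<alpha> > 0\<close> by (intro mult_left_mono) auto
        also have "\<dots> = S u g + (d - c)"
          using \<open>\<alpha> > 0\<close> \<open>n > 0\<close> by (simp add: S_def \<epsilon>_def field_simps)
        finally have le: "S f g \<le> S u g + (d - c)" .
        have S0: "S u g \<ge> 0" using \<open>\<alpha> > 0\<close> by (simp add: S_def sum_nonneg)
        \<comment> \<open>The finite term \<open>ennreal (d - c)\<close> appears at both ends of
          this chain and is cancelled.\<close>
        have "ennreal c + ennreal (d - c) = y''"
          using c d by (simp flip: ennreal_plus)
        also have "\<dots> \<le> E g + ennreal (S f g)"
          using y'' A_le[of f g] by simp
        also have "\<dots> \<le> E g + ennreal (S u g + (d - c))"
          using le by (intro add_left_mono ennreal_leI)
        also have "\<dots> = (E g + ennreal (S u g)) + ennreal (d - c)"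
          using S0 d by (simp add: ennreal_plus add.assoc)
        finally show ?thesis
          using c by (simp add: ennreal_add_left_cancel_le add.commute[of _ "ennreal (d - c)"])
      qed
      then have "y' \<le> ?A u"
        unfolding approx_functional_def S_def by (rule INF_greatest)
      with y' show "y < ?A u" by simp
    qed
  qed
  then show "?A f \<le> Liminf F ?A"
    by (simp add: le_Liminf_iff)
qed

lemma approx_functional_ge:
  assumes "pointwise_lsc E" "p > 0" "c < E f"
  obtains \<alpha> K where "finite K" "\<alpha> > 0" "c \<le> approx_functional E p \<alpha> K f"
proof -
  obtain K e where K: "finite K" "e > 0"
    and near: "\<And>g. (\<And>x. x \<in> K \<Longrightarrow> \<bar>f x - g x\<bar> < e) \<Longrightarrow> c < E g"
    using pointwise_lsc_neighbourhood[OF assms(1,3)] by blast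
  obtain r where r: "r \<ge> 0" "c = ennreal r"
    using \<open>c < E f\<close> by (cases c) auto
  \<comment> \<open>Chosen so that \<open>\<alpha> * e powr p = r + 1\<close>, above
    \<open>r\<close>; the added 1 keeps \<alpha> positive when \<open>r = 0\<close>.\<close>
  define \<alpha> where "\<alpha> = (r + 1) / e powr p"
  have "\<alpha> > 0" using r K by (simp add: \<alpha>_def)
  have "c \<le> E g + ennreal (\<alpha> * (\<Sum>x\<in>K. \<bar>f x - g x\<bar> powr p))" for g
  proof (cases "\<forall>x\<in>K. \<bar>f x - g x\<bar> < e")
    case True
    then have "c \<le> E g" using near[of g] by simp
    then show ?thesis by (simp add: add_increasing2)
  next
    case False
    then obtain x where x: "x \<in> K" "e \<le> \<bar>f x - g x\<bar>" by (auto simp: not_less)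
    have "e powr p \<le> \<bar>f x - g x\<bar> powr p"
      using x K \<open>p > 0\<close> by (intro powr_mono2) auto
    also have "\<dots> \<le> (\<Sum>x\<in>K. \<bar>f x - g x\<bar> powr p)"
      using x K by (intro member_le_sum) auto
    finally have "\<alpha> * e powr p \<le> \<alpha> * (\<Sum>x\<in>K. \<bar>f x - g x\<bar> powr p)"
      using \<open>\<alpha> > 0\<close> by simp
    then have "c \<le> ennreal (\<alpha> * (\<Sum>x\<in>K. \<bar>f x - g x\<bar> powr p))"
      using r K by (auto simp: \<alpha>_def intro!: ennreal_leI)
    then show ?thesis by (simp add: add_increasing)
  qed
  then have "c \<le> approx_functional E p \<alpha> K f"
    unfolding approx_functional_def by (rule INF_greatest)
  with K \<open>\<alpha> > 0\<close> show thesis by (intro that)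
qed

lemma pointwise_lsc_iff_Sup_approx_functional:
  fixes E :: "('a \<Rightarrow> real) \<Rightarrow> ennreal"
  assumes "p > 0"
  shows "pointwise_lsc E \<longleftrightarrow>
    E = Sup {approx_functional E p \<alpha> K | \<alpha> K. finite K \<and> 0 < \<alpha>}" (is "_ \<longleftrightarrow> E = Sup ?S")
proof
  assume lsc: "pointwise_lsc E"
  show "E = Sup ?S"
  proof (rule ext, rule antisym)
    fix f
    show "E f \<le> Sup ?S f"
    \<comment> \<open>Working with all \<open>c\<close> strictly below \<open>E f\<close> also
      covers the case of an infinite \<open>E f\<close>.\<close>
    proof (rule dense_le)
      fix c assume "c < E f"
      then obtain \<alpha> K where "finite K" "\<alpha> > 0" "c \<le> approx_functional E p \<alpha> K f"
        using approx_functional_ge[OF lsc assms] by blast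
      then show "c \<le> Sup ?S f"
        by (auto intro!: SUP_upper2[of "approx_functional E p \<alpha> K"])
    qed
    show "Sup ?S f \<le> E f"
      by (auto intro!: SUP_least approx_functional_le)
  qed
next
  assume E: "E = Sup ?S"
  have "pointwise_lsc (Sup ?S)"
    using assms by (intro pointwise_lsc_Sup) (auto intro: pointwise_lsc_approx_functional)
  then show "pointwise_lsc E"
    by (subst E)
qed

theorem theorem3p15:
  fixes E :: "('a \<Rightarrow> real) \<Rightarrow> ennreal"
  assumes "convex_functional E" and "E (\<lambda>x. 0) = 0"
  shows "(pointwise_lsc E \<longleftrightarrow>
            (\<exists>p::real. 1 \<le> p \<and>
              E = Sup {approx_functional E p \<alpha> K | \<alpha> K. finite K \<and> 0 < \<alpha>})) \<and>
         (pointwise_lsc E \<longleftrightarrow>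
            (\<forall>p::real. 1 \<le> p \<longrightarrow>
              E = Sup {approx_functional E p \<alpha> K | \<alpha> K. finite K \<and> 0 < \<alpha>}))"
proof -
  have "pointwise_lsc E \<longleftrightarrow> E = Sup {approx_functional E p \<alpha> K | \<alpha> K. finite K \<and> 0 < \<alpha>}"
    if "1 \<le> p" for p
    using that by (intro pointwise_lsc_iff_Sup_approx_functional) simp
  \<comment> \<open>The left-hand side does not depend on \<open>p\<close>. The exponent 1,
    admissible by \<open>order_refl\<close>, serves as the witness for the existential and as the
    instance of the universal statement.\<close>
  then show ?thesis
    by (meson order_refl)
qed

end
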